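(* Let $M$ be a Riemannian manifold, let $\eta:M\times M\to TM$ satisfy $\eta(u,v)\in T_vM$ for all $u,v\in M$, and let $m$ be a positive integer. Let $S\subseteq M$ be an open geodesic invex set with respect to $\eta$, let $h:S\to\mathbb{R}$ be a continuously differentiable function, and suppose that $\eta$ satisfies Condition C. Then $h$ is strongly $\eta$-invex of order $m$ with respect to $\eta$ on $S$ if and only if $h$ is strongly geodesic preinvex of order $m$ with respect to $\eta$.
   Context: Manifolds are $C^\infty$, modelled on a Hilbert space (finite or infinite dimensional), with Riemannian metric $\langle\cdot,\cdot\rangle_p$ and norm $\|\cdot\|_p$ on $T_pM$. For a curve $r$, $P_{t_0,r}^{t}:T_{r(t_0)}M\to T_{r(t)}M$ denotes parallel translation along $r$ (with respect to the Levi-Civita connection). Geodesic invex set: a nonempty set $S\subseteq M$ is geodesic invex with respect to $\eta$ if for all $u,v\in S$ there is exactly one geodesic $r_{u,v}:[0,1]\to M$ such that $r_{u,v}(0)=v$, $r_{u,v}'(0)=\eta(u,v)$ and $r_{u,v}(s)\in S$ for all $s\in[0,1]$. Condition C: for all $u,v\in S$ and $s\in[0,1]$, with $r_{u,v}$ the geodesic above, $$(C_1)\quad \eta(v,r_{u,v}(s))=-s\,P_{0,r_{u,v}}^{s}[\eta(u,v)],\qquad (C_2)\quad \eta(u,r_{u,v}(s))=(1-s)\,P_{0,r_{u,v}}^{s}[\eta(u,v)].$$ Strongly geodesic preinvex of order $m$ with respect to $\eta$ (for $h:S\to\mathbb{R}$): there exists $\delta>0$ such that for all $u,v\in S$ and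 $s\in[0,1]$, $$h(r_{u,v}(s))\le s\,h(u)+(1-s)h(v)-\delta s(1-s)\|\eta(u,v)\|_v^m .$$ Strongly $\eta$-invex of order $m$ with respect to $\eta$ on $S$ (for differentiable $h:S\to\mathbb{R}$): there exists $\delta>0$ such that for all $u,v\in S$, $$h(u)\ge h(v)+dh_v(\eta(u,v))+\delta\|\eta(u,v)\|_v^m .$$ The constants $\delta$ in the two definitions need not be equal. *)

theory Defs
  imports "HOL-Analysis.Analysis"
begin

text \<open>
  Riemannian manifolds modelled on a real Hilbert space, which is a type \<open>'e\<close> of sort
  \<open>{real_inner, banach}\<close> and may be finite- or infinite-dimensional.
\<close>

section \<open>Smooth maps between normed spaces\<close>

definition multilinear :: "nat \<Rightarrow> ('e::real_normed_vector list \<Rightarrow> 'f::real_normed_vector) \<Rightarrow> bool"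
  where "multilinear k L \<longleftrightarrow>
    (\<forall>vs i. length vs = k \<longrightarrow> i < k \<longrightarrow> linear (\<lambda>v. L (vs[i := v])))"

definition bounded_multilinear ::
    "nat \<Rightarrow> ('e::real_normed_vector list \<Rightarrow> 'f::real_normed_vector) \<Rightarrow> bool"
  where "bounded_multilinear k L \<longleftrightarrow> multilinear k L \<and>
    (\<exists>K. \<forall>vs. length vs = k \<longrightarrow> norm (L vs) \<le> K * prod_list (map norm vs))"

text \<open>
  \<open>D k x\<close> is the \<open>k\<close>-th Frechet derivative of \<open>f\<close> at \<open>x\<close>, a bounded \<open>k\<close>-linear map whose arguments
  are given as a list of length \<open>k\<close>. The space of bounded linear maps from \<open>'e\<close> to the bounded
  \<open>k\<close>-linear maps is identified with the bounded \<open>(k+1)\<close>-linear maps, so the last conjunct says that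
  \<open>D k\<close> is Frechet differentiable at \<open>x\<close>, in the operator norm, with derivative \<open>D (Suc k) x\<close>.
  The set \<open>W\<close> is meant to be open.
\<close>

definition smooth_on :: "'e set \<Rightarrow> ('e::real_normed_vector \<Rightarrow> 'f::real_normed_vector) \<Rightarrow> bool"
  where "smooth_on W f \<longleftrightarrow>
    (\<exists>D :: nat \<Rightarrow> 'e \<Rightarrow> 'e list \<Rightarrow> 'f.
       (\<forall>x\<in>W. D 0 x [] = f x) \<and>
       (\<forall>k. \<forall>x\<in>W. bounded_multilinear k (D k x)) \<and>
       (\<forall>k. \<forall>x\<in>W. \<forall>\<epsilon>>0. \<forall>\<^sub>F y in at x. \<forall>vs. length vs = k \<longrightarrow>
          norm (D k y vs - D k x vs - D (Suc k) x ((y - x) # vs))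
            \<le> \<epsilon> * norm (y - x) * prod_list (map norm vs)))"


section \<open>Manifolds and tangent vectors\<close>

type_synonym ('a, 'e) chart = "'a set \<times> ('a \<Rightarrow> 'e)"

definition chart_dom :: "('a, 'e) chart \<Rightarrow> 'a set"
  where "chart_dom c = fst c"

definition chart_map :: "('a, 'e) chart \<Rightarrow> 'a \<Rightarrow> 'e"
  where "chart_map c = snd c"

definition chart_img :: "('a, 'e) chart \<Rightarrow> 'e set"
  where "chart_img c = chart_map c ` chart_dom c"

definition chart_inv :: "('a, 'e) chart \<Rightarrow> 'e \<Rightarrow> 'a"
  where "chart_inv c = inv_into (chart_dom c) (chart_map c)"

definition transition :: "('a, 'e) chart \<Rightarrow> ('a, 'e) chart \<Rightarrow> 'e \<Rightarrow> 'e"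
  where "transition c c' = chart_map c' \<circ> chart_inv c"

text \<open>The atlas \<open>A\<close> is not required to be maximal.\<close>

definition smooth_manifold ::
    "'a topology \<Rightarrow> ('a, 'e::{real_inner, banach}) chart set \<Rightarrow> bool"
  where "smooth_manifold X A \<longleftrightarrow>
    Hausdorff_space X \<and>
    topspace X = (\<Union>c\<in>A. chart_dom c) \<and>
    (\<forall>c\<in>A. openin X (chart_dom c) \<and> open (chart_img c) \<and>
       homeomorphic_map (subtopology X (chart_dom c)) (top_of_set (chart_img c)) (chart_map c)) \<and>
    (\<forall>c\<in>A. \<forall>c'\<in>A.
       smooth_on (chart_map c ` (chart_dom c \<inter> chart_dom c')) (transition c c'))"

text \<open>
  A tangent vector at \<open>p\<close> is a class of pairs \<open>(c, v)\<close>, where \<open>c\<close> is a chart at \<open>p\<close> and \<open>v\<close> a vector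
  of the model space, two pairs being equivalent if the derivative of the transition map takes one
  vector to the other. The class is encoded as the function \<open>\<xi>\<close> sending each chart \<open>c\<close> of the atlas
  at \<open>p\<close> to its unique \<open>v\<close>, and everything else to \<open>0\<close>. The vector space operations are pointwise.
\<close>

type_synonym ('a, 'e) tvec = "('a, 'e) chart \<Rightarrow> 'e"

definition tangent_space ::
    "('a, 'e::{real_inner, banach}) chart set \<Rightarrow> 'a \<Rightarrow> ('a, 'e) tvec set"
  where "tangent_space A p = {\<xi>.
    (\<forall>c\<in>A. \<forall>c'\<in>A. p \<in> chart_dom c \<longrightarrow> p \<in> chart_dom c' \<longrightarrow>
       \<xi> c' = frechet_derivative (transition c c') (at (chart_map c p)) (\<xi> c)) \<and>
    (\<forall>c. \<not> (c \<in> A \<and> p \<in> chart_dom c) \<longrightarrow> \<xi> c = 0)}"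

definition tscale :: "real \<Rightarrow> ('a, 'e::real_vector) tvec \<Rightarrow> ('a, 'e) tvec"
  where "tscale a \<xi> = (\<lambda>c. a *\<^sub>R \<xi> c)"

text \<open>The tangent vector at \<open>p\<close> whose representative in the chart \<open>c\<close> is \<open>v\<close>.\<close>

definition tvec_of ::
    "('a, 'e::{real_inner, banach}) chart set \<Rightarrow> ('a, 'e) chart \<Rightarrow> 'a \<Rightarrow> 'e \<Rightarrow> ('a, 'e) tvec"
  where "tvec_of A c p v = (\<lambda>c'. if c' \<in> A \<and> p \<in> chart_dom c'
    then frechet_derivative (transition c c') (at (chart_map c p)) v else 0)"


section \<open>Riemannian metrics and the Levi-Civita connection\<close>

definition metric_rep ::
    "('a, 'e::{real_inner, banach}) chart set \<Rightarrow> ('a \<Rightarrow> ('a, 'e) tvec \<Rightarrow> ('a, 'e) tvec \<Rightarrow> real)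
      \<Rightarrow> ('a, 'e) chart \<Rightarrow> 'e \<Rightarrow> 'e \<Rightarrow> 'e \<Rightarrow> real"
  where "metric_rep A g c x v w =
    (let p = chart_inv c x in g p (tvec_of A c p v) (tvec_of A c p w))"

text \<open>
  The last conjunct, together with the boundedness of \<open>G x\<close>, says that the inner product on each
  tangent space induces its given topology. In finite dimension it amounts to positive definiteness.
\<close>

definition riemannian_metric ::
    "('a, 'e::{real_inner, banach}) chart set \<Rightarrow> ('a \<Rightarrow> ('a, 'e) tvec \<Rightarrow> ('a, 'e) tvec \<Rightarrow> real)
      \<Rightarrow> bool"
  where "riemannian_metric A g \<longleftrightarrow>
    (\<forall>c\<in>A. \<exists>G :: 'e \<Rightarrow> ('e \<Rightarrow>\<^sub>L 'e \<Rightarrow>\<^sub>L real).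
       smooth_on (chart_img c) G \<and>
       (\<forall>x\<in>chart_img c.
          (\<forall>v w. metric_rep A g c x v w = blinfun_apply (blinfun_apply (G x) v) w) \<and>
          (\<forall>v w. metric_rep A g c x v w = metric_rep A g c x w v) \<and>
          (\<exists>k>0. \<forall>v. k * (norm v)\<^sup>2 \<le> metric_rep A g c x v v)))"

definition tnorm :: "('a \<Rightarrow> ('a, 'e) tvec \<Rightarrow> ('a, 'e) tvec \<Rightarrow> real) \<Rightarrow> 'a \<Rightarrow> ('a, 'e) tvec \<Rightarrow> real"
  where "tnorm g p \<xi> = sqrt (g p \<xi> \<xi>)"

text \<open>
  A linear connection is given by its Christoffel maps \<open>\<Gamma> c\<close>: in the chart \<open>c\<close>, the covariant
  derivative of a vector field \<open>Y\<close> in the direction \<open>v\<close> at \<open>x\<close> is \<open>DY(x) v + \<Gamma> c x v (Y x)\<close>. The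
  transformation rule, in which the second derivative of the transition map occurs, expresses that
  this vector does not depend on the chart.
\<close>

definition connection ::
    "('a, 'e::{real_inner, banach}) chart set \<Rightarrow> (('a, 'e) chart \<Rightarrow> 'e \<Rightarrow> ('e \<Rightarrow>\<^sub>L 'e \<Rightarrow>\<^sub>L 'e)) \<Rightarrow> bool"
  where "connection A \<Gamma> \<longleftrightarrow>
    (\<forall>c\<in>A. smooth_on (chart_img c) (\<Gamma> c)) \<and>
    (\<forall>c\<in>A. \<forall>c'\<in>A. \<forall>p \<in> chart_dom c \<inter> chart_dom c'. \<forall>v w.
       let x = chart_map c p; \<tau> = transition c c'; D = (\<lambda>y. frechet_derivative \<tau> (at y)) in
       blinfun_apply (blinfun_apply (\<Gamma> c' (chart_map c' p)) (D x v)) (D x w) =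
         D x (blinfun_apply (blinfun_apply (\<Gamma> c x) v) w)
           - frechet_derivative (\<lambda>y. D y w) (at x) v)"

text \<open>
  The three conjuncts say that \<open>\<Gamma>\<close> is a linear connection, that it is torsion-free, and that it is
  compatible with the metric. These properties determine \<open>\<Gamma> c\<close> on the image of \<open>c\<close>.
\<close>

definition levi_civita ::
    "('a, 'e::{real_inner, banach}) chart set \<Rightarrow> ('a \<Rightarrow> ('a, 'e) tvec \<Rightarrow> ('a, 'e) tvec \<Rightarrow> real)
      \<Rightarrow> (('a, 'e) chart \<Rightarrow> 'e \<Rightarrow> ('e \<Rightarrow>\<^sub>L 'e \<Rightarrow>\<^sub>L 'e)) \<Rightarrow> bool"
  where "levi_civita A g \<Gamma> \<longleftrightarrow>
    connection A \<Gamma> \<and>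
    (\<forall>c\<in>A. \<forall>x\<in>chart_img c. \<forall>v w.
       blinfun_apply (blinfun_apply (\<Gamma> c x) v) w = blinfun_apply (blinfun_apply (\<Gamma> c x) w) v) \<and>
    (\<forall>c\<in>A. \<forall>x\<in>chart_img c. \<forall>v w.
       ((\<lambda>y. metric_rep A g c y v w) has_derivative
         (\<lambda>z. metric_rep A g c x (blinfun_apply (blinfun_apply (\<Gamma> c x) z) v) w
            + metric_rep A g c x v (blinfun_apply (blinfun_apply (\<Gamma> c x) z) w))) (at x))"


section \<open>Curves, parallel translation and geodesics\<close>

definition differentiable_curve ::
    "'a topology \<Rightarrow> ('a, 'e::{real_inner, banach}) chart set \<Rightarrow> real set \<Rightarrow> (real \<Rightarrow> 'a) \<Rightarrow> bool"
  where "differentiable_curve X A I r \<longleftrightarrow>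
    continuous_map (top_of_set I) X r \<and>
    (\<forall>c\<in>A. \<forall>t\<in>I. r t \<in> chart_dom c \<longrightarrow> (chart_map c \<circ> r) differentiable (at t within I))"

definition velocity ::
    "('a, 'e::{real_inner, banach}) chart set \<Rightarrow> real set \<Rightarrow> (real \<Rightarrow> 'a) \<Rightarrow> real \<Rightarrow> ('a, 'e) tvec"
  where "velocity A I r t = (\<lambda>c. if c \<in> A \<and> r t \<in> chart_dom c
    then vector_derivative (chart_map c \<circ> r) (at t within I) else 0)"

text \<open>
  \<open>V\<close> is a vector field along \<open>r\<close> with vanishing covariant derivative. Only values at parameters
  near \<open>t\<close> enter the derivative, and there \<open>r\<close> stays in the domain of \<open>c\<close>.
\<close>

definition parallel_along ::
    "('a, 'e::{real_inner, banach}) chart set \<Rightarrow> (('a, 'e) chart \<Rightarrow> 'e \<Rightarrow> ('e \<Rightarrow>\<^sub>L 'e \<Rightarrow>\<^sub>L 'e))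
      \<Rightarrow> real set \<Rightarrow> (real \<Rightarrow> 'a) \<Rightarrow> (real \<Rightarrow> ('a, 'e) tvec) \<Rightarrow> bool"
  where "parallel_along A \<Gamma> I r V \<longleftrightarrow>
    (\<forall>t\<in>I. V t \<in> tangent_space A (r t)) \<and>
    (\<forall>c\<in>A. \<forall>t\<in>I. r t \<in> chart_dom c \<longrightarrow>
       ((\<lambda>s. V s c) has_vector_derivative
         - blinfun_apply (blinfun_apply (\<Gamma> c (chart_map c (r t))) (velocity A I r t c)) (V t c))
       (at t within I))"

definition parallel_translation ::
    "('a, 'e::{real_inner, banach}) chart set \<Rightarrow> (('a, 'e) chart \<Rightarrow> 'e \<Rightarrow> ('e \<Rightarrow>\<^sub>L 'e \<Rightarrow>\<^sub>L 'e))
      \<Rightarrow> real set \<Rightarrow> (real \<Rightarrow> 'a) \<Rightarrow> real \<Rightarrow> real \<Rightarrow> ('a, 'e) tvec \<Rightarrow> ('a, 'e) tvec"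
  where "parallel_translation A \<Gamma> I r t\<^sub>0 t \<xi> =
    (THE \<zeta>. \<exists>V. parallel_along A \<Gamma> I r V \<and> V t\<^sub>0 = \<xi> \<and> V t = \<zeta>)"

text \<open>Geodesics are then automatically of class \<open>C\<^sup>\<infinity>\<close>, because the Christoffel maps are smooth.\<close>

definition geodesic ::
    "'a topology \<Rightarrow> ('a, 'e::{real_inner, banach}) chart set
      \<Rightarrow> (('a, 'e) chart \<Rightarrow> 'e \<Rightarrow> ('e \<Rightarrow>\<^sub>L 'e \<Rightarrow>\<^sub>L 'e)) \<Rightarrow> real set \<Rightarrow> (real \<Rightarrow> 'a) \<Rightarrow> bool"
  where "geodesic X A \<Gamma> I r \<longleftrightarrow>
    differentiable_curve X A I r \<and> parallel_along A \<Gamma> I r (velocity A I r)"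


section \<open>Differentiable real functions\<close>

definition C1_on ::
    "('a, 'e::{real_inner, banach}) chart set \<Rightarrow> 'a set \<Rightarrow> ('a \<Rightarrow> real) \<Rightarrow> bool"
  where "C1_on A S h \<longleftrightarrow>
    (\<forall>c\<in>A. \<exists>h' :: 'e \<Rightarrow> ('e \<Rightarrow>\<^sub>L real).
       (\<forall>x \<in> chart_map c ` (chart_dom c \<inter> S).
          ((h \<circ> chart_inv c) has_derivative blinfun_apply (h' x)) (at x)) \<and>
       continuous_on (chart_map c ` (chart_dom c \<inter> S)) h')"

text \<open>By the chain rule the differential does not depend on the chart chosen.\<close>

definition differential ::
    "('a, 'e::{real_inner, banach}) chart set \<Rightarrow> ('a \<Rightarrow> real) \<Rightarrow> 'a \<Rightarrow> ('a, 'e) tvec \<Rightarrow> real"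
  where "differential A h p \<xi> =
    (let c = (SOME c. c \<in> A \<and> p \<in> chart_dom c)
     in frechet_derivative (h \<circ> chart_inv c) (at (chart_map c p)) (\<xi> c))"


section \<open>Geodesic invexity and Condition C\<close>

text \<open>Curves on \<open>[0,1]\<close> are extensional, so that equality of functions is equality on \<open>[0,1]\<close>.\<close>

definition invex_geodesic ::
    "'a topology \<Rightarrow> ('a, 'e::{real_inner, banach}) chart set
      \<Rightarrow> (('a, 'e) chart \<Rightarrow> 'e \<Rightarrow> ('e \<Rightarrow>\<^sub>L 'e \<Rightarrow>\<^sub>L 'e)) \<Rightarrow> ('a \<Rightarrow> 'a \<Rightarrow> ('a, 'e) tvec)
      \<Rightarrow> 'a set \<Rightarrow> 'a \<Rightarrow> 'a \<Rightarrow> (real \<Rightarrow> 'a) \<Rightarrow> bool"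
  where "invex_geodesic X A \<Gamma> \<eta> S u v r \<longleftrightarrow>
    r \<in> extensional {0..1} \<and> geodesic X A \<Gamma> {0..1} r \<and>
    r 0 = v \<and> velocity A {0..1} r 0 = \<eta> u v \<and> (\<forall>s\<in>{0..1}. r s \<in> S)"

definition geodesic_invex ::
    "'a topology \<Rightarrow> ('a, 'e::{real_inner, banach}) chart set
      \<Rightarrow> (('a, 'e) chart \<Rightarrow> 'e \<Rightarrow> ('e \<Rightarrow>\<^sub>L 'e \<Rightarrow>\<^sub>L 'e)) \<Rightarrow> ('a \<Rightarrow> 'a \<Rightarrow> ('a, 'e) tvec)
      \<Rightarrow> 'a set \<Rightarrow> bool"
  where "geodesic_invex X A \<Gamma> \<eta> S \<longleftrightarrow>
    S \<noteq> {} \<and> S \<subseteq> topspace X \<and>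
    (\<forall>u\<in>S. \<forall>v\<in>S. \<exists>!r. invex_geodesic X A \<Gamma> \<eta> S u v r)"

definition geod ::
    "'a topology \<Rightarrow> ('a, 'e::{real_inner, banach}) chart set
      \<Rightarrow> (('a, 'e) chart \<Rightarrow> 'e \<Rightarrow> ('e \<Rightarrow>\<^sub>L 'e \<Rightarrow>\<^sub>L 'e)) \<Rightarrow> ('a \<Rightarrow> 'a \<Rightarrow> ('a, 'e) tvec)
      \<Rightarrow> 'a set \<Rightarrow> 'a \<Rightarrow> 'a \<Rightarrow> real \<Rightarrow> 'a"
  where "geod X A \<Gamma> \<eta> S u v = (THE r. invex_geodesic X A \<Gamma> \<eta> S u v r)"

definition condition_C ::
    "'a topology \<Rightarrow> ('a, 'e::{real_inner, banach}) chart set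
      \<Rightarrow> (('a, 'e) chart \<Rightarrow> 'e \<Rightarrow> ('e \<Rightarrow>\<^sub>L 'e \<Rightarrow>\<^sub>L 'e)) \<Rightarrow> ('a \<Rightarrow> 'a \<Rightarrow> ('a, 'e) tvec)
      \<Rightarrow> 'a set \<Rightarrow> bool"
  where "condition_C X A \<Gamma> \<eta> S \<longleftrightarrow>
    (\<forall>u\<in>S. \<forall>v\<in>S. \<forall>s\<in>{0..1}.
       let r = geod X A \<Gamma> \<eta> S u v; \<zeta> = parallel_translation A \<Gamma> {0..1} r 0 s (\<eta> u v) in
       \<eta> v (r s) = tscale (- s) \<zeta> \<and> \<eta> u (r s) = tscale (1 - s) \<zeta>)"

definition strongly_geodesic_preinvex ::
    "'a topology \<Rightarrow> ('a, 'e::{real_inner, banach}) chart set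
      \<Rightarrow> ('a \<Rightarrow> ('a, 'e) tvec \<Rightarrow> ('a, 'e) tvec \<Rightarrow> real)
      \<Rightarrow> (('a, 'e) chart \<Rightarrow> 'e \<Rightarrow> ('e \<Rightarrow>\<^sub>L 'e \<Rightarrow>\<^sub>L 'e)) \<Rightarrow> ('a \<Rightarrow> 'a \<Rightarrow> ('a, 'e) tvec)
      \<Rightarrow> 'a set \<Rightarrow> nat \<Rightarrow> ('a \<Rightarrow> real) \<Rightarrow> bool"
  where "strongly_geodesic_preinvex X A g \<Gamma> \<eta> S m h \<longleftrightarrow>
    (\<exists>\<delta>>0. \<forall>u\<in>S. \<forall>v\<in>S. \<forall>s\<in>{0..1}.
       h (geod X A \<Gamma> \<eta> S u v s)
         \<le> s * h u + (1 - s) * h v - \<delta> * s * (1 - s) * tnorm g v (\<eta> u v) ^ m)"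

definition strongly_invex ::
    "('a, 'e::{real_inner, banach}) chart set
      \<Rightarrow> ('a \<Rightarrow> ('a, 'e) tvec \<Rightarrow> ('a, 'e) tvec \<Rightarrow> real) \<Rightarrow> ('a \<Rightarrow> 'a \<Rightarrow> ('a, 'e) tvec)
      \<Rightarrow> 'a set \<Rightarrow> nat \<Rightarrow> ('a \<Rightarrow> real) \<Rightarrow> bool"
  where "strongly_invex A g \<eta> S m h \<longleftrightarrow>
    (\<exists>\<delta>>0. \<forall>u\<in>S. \<forall>v\<in>S.
       h u \<ge> h v + differential A h v (\<eta> u v) + \<delta> * tnorm g v (\<eta> u v) ^ m)"

end

theory Submission
  imports Defs
begin

text \<open>
  Parallel fields along a curve have constant length, because the connection is compatible with
  the metric. Applied to the difference of two parallel fields, this shows that parallel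
  translation is well defined without any theory of differential equations; along a geodesic
  \<open>r\<close> it carries \<open>r'(0)\<close> to \<open>r'(s)\<close>, a vector of the same length.

  If \<open>h\<close> is strongly preinvex, dividing by \<open>s\<close> and letting \<open>s \<rightarrow> 0\<close> gives invexity. Conversely, by
  Condition C, invexity at \<open>r(s)\<close> against \<open>u\<close> and against \<open>v\<close> involves \<open>dh((1 - s) r'(s))\<close> and
  \<open>dh(- s r'(s))\<close>. In the convex combination with weights \<open>s\<close> and \<open>1 - s\<close> the differentials
  cancel, and the remaining term is
  \<open>\<delta> (s (1 - s)^m + (1 - s) s^m) N^m \<ge> (\<delta> / 2^(m-1)) s (1 - s) N^m\<close>, where \<open>N\<close> is the length of
  \<open>\<eta>(u, v)\<close>.
\<close>

section \<open>First derivatives of smooth maps\<close>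

lemma smooth_on_imp_has_derivative:
  assumes "smooth_on W f" "open W" "x \<in> W"
  obtains f' where "(f has_derivative f') (at x)"
proof -
  obtain D where D0: "\<forall>x\<in>W. D 0 x [] = f x"
    and bm: "\<forall>k. \<forall>x\<in>W. bounded_multilinear k (D k x)"
    and lim: "\<forall>k. \<forall>x\<in>W. \<forall>\<epsilon>>0. \<forall>\<^sub>F y in at x. \<forall>vs. length vs = k \<longrightarrow>
          norm (D k y vs - D k x vs - D (Suc k) x ((y - x) # vs))
            \<le> \<epsilon> * norm (y - x) * prod_list (map norm vs)"
    using assms(1) unfolding smooth_on_def by (elim exE conjE)
  \<comment> \<open>Orders \<open>0\<close> and \<open>1\<close> of the tower give the derivative:
    for \<open>k = 0\<close> the argument list is empty, its product of norms is \<open>1\<close>,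
    and the remainder bound says that \<open>D 0\<close> is Frechet differentiable.\<close>
  have bm1: "bounded_multilinear 1 (D 1 x)" using bm assms(3) by blast
  have "linear (\<lambda>v. D 1 x (vs[i := v]))" if "length vs = 1" "i < 1" for vs i
    using bm1 that unfolding bounded_multilinear_def multilinear_def by blast
  \<comment> \<open>Replacing the only entry of \<open>[0]\<close> yields \<open>[v]\<close>, so
    linearity in slot \<open>0\<close> is linearity of the first derivative.\<close>
  from this[of "[0]" 0] have lin: "linear (\<lambda>v. D 1 x [v])" by simp
  obtain K where K: "\<And>vs. length vs = 1 \<Longrightarrow> norm (D 1 x vs) \<le> K * prod_list (map norm vs)"
    using bm1 unfolding bounded_multilinear_def by blast
  have "norm (D 1 x [v]) \<le> norm v * K" for v
    using K[of "[v]"] by (simp add: mult.commute)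
  then have bl: "bounded_linear (\<lambda>v. D 1 x [v])"
    using lin by (simp add: bounded_linear_def bounded_linear_axioms_def) blast
  have "\<forall>\<^sub>F y in at x. norm (f y - f x - D 1 x [y - x]) \<le> e * norm (y - x)" if "e > 0" for e
  proof -
    \<comment> \<open>Openness of \<open>W\<close> allows \<open>D 0 y []\<close> to be read as
      \<open>f y\<close> for all \<open>y\<close> near \<open>x\<close>.\<close>
    have "\<forall>\<^sub>F y in at x. y \<in> W"
      using assms(2,3) by (simp add: eventually_at_in_open')
    moreover have "\<forall>\<^sub>F y in at x. \<forall>vs. length vs = 0 \<longrightarrow>
          norm (D 0 y vs - D 0 x vs - D (Suc 0) x ((y - x) # vs))
            \<le> e * norm (y - x) * prod_list (map norm vs)"
      using lim assms(3) that by blast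
    ultimately show ?thesis
      by eventually_elim (use D0 assms(3) in auto)
  qed
  with bl have "(f has_derivative (\<lambda>v. D 1 x [v])) (at x)"
    by (simp add: has_derivative_within_alt2)
  then show ?thesis by (rule that)
qed

section \<open>Charts and tangent vectors\<close>

lemma inj_on_chart_map:
  assumes "smooth_manifold X A" "c \<in> A"
  shows "inj_on (chart_map c) (chart_dom c)"
proof -
  have "homeomorphic_map (subtopology X (chart_dom c)) (top_of_set (chart_img c)) (chart_map c)"
    "openin X (chart_dom c)"
    using assms by (auto simp: smooth_manifold_def)
  then show ?thesis
    by (metis homeomorphic_imp_injective_map openin_subset topspace_subtopology_subset)
qed

lemma chart_inv_chart_map [simp]:
  assumes "smooth_manifold X A" "c \<in> A" "p \<in> chart_dom c"
  shows "chart_inv c (chart_map c p) = p"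
  using inj_on_chart_map[OF assms(1,2)] assms(3) by (simp add: chart_inv_def)

lemma chart_map_in_img: "p \<in> chart_dom c \<Longrightarrow> chart_map c p \<in> chart_img c"
  by (simp add: chart_img_def)

lemma ex_chart:
  assumes "smooth_manifold X A" "p \<in> topspace X"
  shows "\<exists>c. c \<in> A \<and> p \<in> chart_dom c"
proof -
  have "p \<in> (\<Union>c\<in>A. chart_dom c)"
    using assms unfolding smooth_manifold_def by metis
  then show ?thesis by blast
qed

lemma open_chart_map_image:
  assumes "smooth_manifold X A" "c \<in> A" "openin X U"
  shows "open (chart_map c ` (chart_dom c \<inter> U))"
proof -
  have hm: "homeomorphic_map (subtopology X (chart_dom c)) (top_of_set (chart_img c)) (chart_map c)"
    and o: "openin X (chart_dom c)" "open (chart_img c)"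
    using assms by (auto simp: smooth_manifold_def)
  have "openin (subtopology X (chart_dom c)) (chart_dom c \<inter> U)"
    using assms(3) by (meson openin_subtopology_Int2)
  then have "openin (top_of_set (chart_img c)) (chart_map c ` (chart_dom c \<inter> U))"
    using hm homeomorphic_imp_open_map open_map_def by blast
  then show ?thesis using o(2) openin_open_eq by blast
qed

text \<open>\<open>frechet_derivative\<close> is a choice and means something only once a derivative
  exists. Smoothness provides one, since the chart image of the overlap is open. Linearity of the
  transition derivatives, on which the vector operations on tangent vectors rest, follows from
  this.\<close>

lemma transition_has_derivative:
  assumes M: "smooth_manifold X A" and "c \<in> A" "c' \<in> A" "p \<in> chart_dom c" "p \<in> chart_dom c'"
  shows "(transition c c' has_derivative
    frechet_derivative (transition c c') (at (chart_map c p))) (at (chart_map c p))"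
proof -
  have "openin X (chart_dom c')"
    "smooth_on (chart_map c ` (chart_dom c \<inter> chart_dom c')) (transition c c')"
    using assms by (auto simp: smooth_manifold_def)
  then obtain f' where "(transition c c' has_derivative f') (at (chart_map c p))"
    using smooth_on_imp_has_derivative open_chart_map_image[OF M \<open>c \<in> A\<close>] assms(4,5) by blast
  then show ?thesis
    using differentiableI frechet_derivative_works by blast
qed

lemma tangent_space_transition:
  assumes "\<xi> \<in> tangent_space A p" "c \<in> A" "c' \<in> A" "p \<in> chart_dom c" "p \<in> chart_dom c'"
  shows "\<xi> c' = frechet_derivative (transition c c') (at (chart_map c p)) (\<xi> c)"
  using assms unfolding tangent_space_def by blast

lemma tangent_space_off_chart:
  assumes "\<xi> \<in> tangent_space A p" "\<not> (c \<in> A \<and> p \<in> chart_dom c)"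
  shows "\<xi> c = 0"
  using assms unfolding tangent_space_def by blast

lemma tangent_space_diff:
  assumes M: "smooth_manifold X A" and "\<xi> \<in> tangent_space A p" "\<zeta> \<in> tangent_space A p"
  shows "(\<lambda>c. \<xi> c - \<zeta> c) \<in> tangent_space A p"
proof -
  have "\<xi> c' - \<zeta> c' = frechet_derivative (transition c c') (at (chart_map c p)) (\<xi> c - \<zeta> c)"
    if c: "c \<in> A" "c' \<in> A" "p \<in> chart_dom c" "p \<in> chart_dom c'" for c c'
    using linear_diff[OF has_derivative_linear[OF transition_has_derivative[OF M c]]]
      tangent_space_transition[OF assms(2) c] tangent_space_transition[OF assms(3) c]
    by metis
  moreover have "\<xi> c - \<zeta> c = 0" if "\<not> (c \<in> A \<and> p \<in> chart_dom c)" for c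
    using tangent_space_off_chart[OF assms(2) that] tangent_space_off_chart[OF assms(3) that] by simp
  ultimately show ?thesis
    unfolding tangent_space_def by blast
qed

text \<open>This lets \<open>metric_rep\<close>, which builds its arguments by
  \<open>tvec_of\<close>, be evaluated on given tangent vectors. Off the charts at \<open>p\<close>
  both sides take the default value \<open>0\<close>.\<close>

lemma tvec_of_tangent_vector:
  assumes "\<xi> \<in> tangent_space A p" "c \<in> A" "p \<in> chart_dom c"
  shows "tvec_of A c p (\<xi> c) = \<xi>"
proof
  fix c'
  show "tvec_of A c p (\<xi> c) c' = \<xi> c'"
    using tangent_space_transition[OF assms(1,2) _ assms(3), of c']
      tangent_space_off_chart[OF assms(1), of c'] by (simp add: tvec_of_def)
qed

section \<open>Lengths of tangent vectors\<close>

lemma metric_rep_tangent: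
  assumes M: "smooth_manifold X A"
    and "\<xi> \<in> tangent_space A p" "c \<in> A" "p \<in> chart_dom c"
  shows "metric_rep A g c (chart_map c p) (\<xi> c) (\<xi> c) = g p \<xi> \<xi>"
  using assms by (simp add: metric_rep_def tvec_of_tangent_vector)

lemma riemannian_metric_chartE:
  assumes "riemannian_metric A g" "c \<in> A"
  obtains G :: "'e::{real_inner, banach} \<Rightarrow> ('e \<Rightarrow>\<^sub>L 'e \<Rightarrow>\<^sub>L real)"
  where "smooth_on (chart_img c) G"
    "\<And>x v w. x \<in> chart_img c \<Longrightarrow> metric_rep A g c x v w = G x v w"
    "\<And>x. x \<in> chart_img c \<Longrightarrow> \<exists>k>0. \<forall>v. k * (norm v)\<^sup>2 \<le> G x v v"
proof -
  obtain G :: "'e \<Rightarrow> ('e \<Rightarrow>\<^sub>L 'e \<Rightarrow>\<^sub>L real)" where G: "smooth_on (chart_img c) G"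
       "\<forall>x\<in>chart_img c.
          (\<forall>v w. metric_rep A g c x v w = blinfun_apply (blinfun_apply (G x) v) w) \<and>
          (\<forall>v w. metric_rep A g c x v w = metric_rep A g c x w v) \<and>
          (\<exists>k>0. \<forall>v. k * (norm v)\<^sup>2 \<le> metric_rep A g c x v v)"
    using assms unfolding riemannian_metric_def by blast
  show ?thesis
  proof (rule that[of G])
    show "\<exists>k>0. \<forall>v. k * (norm v)\<^sup>2 \<le> G x v v" if "x \<in> chart_img c" for x
      using G(2) that by metis
  qed (use G in auto)
qed

text \<open>In every chart at \<open>p\<close> the lower bound on the metric puts a positive
  multiple of \<open>(norm (\<xi> c))\<^sup>2\<close> below \<open>g p \<xi> \<xi> = 0\<close>;
  elsewhere the encoding of tangent vectors has the value \<open>0\<close>.\<close>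

lemma tangent_vector_eq_zero:
  assumes M: "smooth_manifold X A" and R: "riemannian_metric A g" and "p \<in> topspace X"
    and T: "\<xi> \<in> tangent_space A p" and z: "g p \<xi> \<xi> = 0"
  shows "\<xi> = (\<lambda>c. 0)"
proof
  fix c
  show "\<xi> c = 0"
  proof (cases "c \<in> A \<and> p \<in> chart_dom c")
    case True
    then obtain G :: "'b \<Rightarrow> ('b \<Rightarrow>\<^sub>L 'b \<Rightarrow>\<^sub>L real)" where
      G: "\<And>x v w. x \<in> chart_img c \<Longrightarrow> metric_rep A g c x v w = G x v w"
        "\<And>x. x \<in> chart_img c \<Longrightarrow> \<exists>k>0. \<forall>v. k * (norm v)\<^sup>2 \<le> G x v v"
      using riemannian_metric_chartE[OF R] by metis
    have x: "chart_map c p \<in> chart_img c" using True by (simp add: chart_map_in_img)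
    then obtain k where "k > 0" "k * (norm (\<xi> c))\<^sup>2 \<le> G (chart_map c p) (\<xi> c) (\<xi> c)"
      using G(2) by blast
    moreover have "G (chart_map c p) (\<xi> c) (\<xi> c) = 0"
      using metric_rep_tangent[OF M T] True G(1)[OF x] z by metis
    ultimately show ?thesis
      by (simp add: mult_le_0_iff)
  next
    case False
    then show ?thesis using tangent_space_off_chart[OF T] by blast
  qed
qed

text \<open>The real \<open>sqrt\<close> is an odd function, so the sign of a length has to come
  from positivity of the metric, read off in one chart.\<close>

lemma tnorm_nonneg:
  assumes M: "smooth_manifold X A" and R: "riemannian_metric A g" and "p \<in> topspace X"
    and T: "\<xi> \<in> tangent_space A p"
  shows "0 \<le> tnorm g p \<xi>"
proof -
  obtain c where c: "c \<in> A" "p \<in> chart_dom c"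
    using ex_chart[OF M assms(3)] by blast
  then obtain k where "k > 0" "\<And>v. k * (norm v)\<^sup>2 \<le> metric_rep A g c (chart_map c p) v v"
    using riemannian_metric_chartE[OF R c(1)] chart_map_in_img by metis
  then have "0 \<le> metric_rep A g c (chart_map c p) (\<xi> c) (\<xi> c)"
    by (meson less_imp_le mult_nonneg_nonneg order_trans zero_le_power2)
  then show ?thesis
    using metric_rep_tangent[OF M T c, of g] by (simp add: tnorm_def)
qed

text \<open>The bilinearity of \<open>g\<close> is accessible only through its form \<open>G\<close>
  in a chart, so both tangent vectors are expressed in one chart first; the factor
  \<open>a * a\<close> then leaves the root as \<open>\<bar>a\<bar>\<close>.\<close>

lemma tnorm_tscale:
  assumes M: "smooth_manifold X A" and R: "riemannian_metric A g" and "p \<in> topspace X"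
    and T: "\<xi> \<in> tangent_space A p" and aT: "tscale a \<xi> \<in> tangent_space A p"
  shows "tnorm g p (tscale a \<xi>) = \<bar>a\<bar> * tnorm g p \<xi>"
proof -
  obtain c where c: "c \<in> A" "p \<in> chart_dom c"
    using ex_chart[OF M assms(3)] by blast
  obtain G :: "'b \<Rightarrow> ('b \<Rightarrow>\<^sub>L 'b \<Rightarrow>\<^sub>L real)" where
      G: "\<And>x v w. x \<in> chart_img c \<Longrightarrow> metric_rep A g c x v w = G x v w"
    using riemannian_metric_chartE[OF R c(1)] by metis
  have "g p (tscale a \<xi>) (tscale a \<xi>) = a * a * g p \<xi> \<xi>"
    using metric_rep_tangent[OF M T c, of g] metric_rep_tangent[OF M aT c, of g]
    by (simp add: G chart_map_in_img c tscale_def blinfun.scaleR_left blinfun.scaleR_right)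
  then show ?thesis
    by (simp add: tnorm_def real_sqrt_mult)
qed

section \<open>Curves and parallel fields\<close>

lemma eventually_in_chart_dom:
  assumes M: "smooth_manifold X A" and "differentiable_curve X A I r"
    and "c \<in> A" "t \<in> I" "r t \<in> chart_dom c"
  shows "\<forall>\<^sub>F s in at t within I. r s \<in> chart_dom c"
proof -
  have "openin X (chart_dom c)" "continuous_map (top_of_set I) X r"
    using assms by (auto simp: smooth_manifold_def differentiable_curve_def)
  then have "openin (top_of_set I) {s \<in> topspace (top_of_set I). r s \<in> chart_dom c}"
    using openin_continuous_map_preimage by blast
  then obtain T where "open T" and T: "{s \<in> I. r s \<in> chart_dom c} = I \<inter> T"
    by (auto simp: openin_open)
  then have "\<forall>\<^sub>F s in at t within I. s \<in> T"
    using assms(4,5) eventually_at_in_open'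
    by (metis (mono_tags) Int_iff at_le filter_leD mem_Collect_eq subset_UNIV)
  moreover have "\<forall>\<^sub>F s in at t within I. s \<in> I"
    by (simp add: eventually_at_filter)
  ultimately show ?thesis
    by eventually_elim (use T in auto)
qed

lemma velocity_has_vector_derivative:
  assumes "differentiable_curve X A I r" "c \<in> A" "t \<in> I" "r t \<in> chart_dom c"
  shows "((chart_map c \<circ> r) has_vector_derivative velocity A I r t c) (at t within I)"
  using assms unfolding differentiable_curve_def velocity_def
  by (simp add: vector_derivative_works)

lemma parallel_along_diff:
  assumes M: "smooth_manifold X A"
    and V: "parallel_along A \<Gamma> I r V" and W: "parallel_along A \<Gamma> I r W"
  shows "parallel_along A \<Gamma> I r (\<lambda>t c. V t c - W t c)"
  unfolding parallel_along_def
proof (intro conjI ballI impI)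
  fix t assume "t \<in> I"
  then show "(\<lambda>c. V t c - W t c) \<in> tangent_space A (r t)"
    using tangent_space_diff[OF M] V W by (simp add: parallel_along_def)
next
  fix c t assume ct: "c \<in> A" "t \<in> I" "r t \<in> chart_dom c"
  let ?F = "blinfun_apply (blinfun_apply (\<Gamma> c (chart_map c (r t))) (velocity A I r t c))"
  have "((\<lambda>s. V s c - W s c) has_vector_derivative - ?F (V t c) - - ?F (W t c)) (at t within I)"
    by (rule has_vector_derivative_diff) (use V W ct in \<open>auto simp: parallel_along_def\<close>)
  then show "((\<lambda>s. V s c - W s c) has_vector_derivative - ?F (V t c - W t c)) (at t within I)"
    by (simp add: blinfun.diff_right)
qed

text \<open>In a chart the product rule gives the derivative of \<open>G\<close> along the velocity
  \<open>z\<close>, plus two terms containing \<open>w = - \<Gamma> c x z v\<close>, the derivative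
  of the field. Compatibility with the metric makes the first term
  \<open>- G x w v - G x v w\<close>, and everything cancels.\<close>

lemma parallel_norm_derivative:
  assumes M: "smooth_manifold X A" and R: "riemannian_metric A g" and L: "levi_civita A g \<Gamma>"
    and r: "differentiable_curve X A I r" and V: "parallel_along A \<Gamma> I r V"
    and t: "t \<in> I"
  shows "((\<lambda>s. g (r s) (V s) (V s)) has_vector_derivative 0) (at t within I)"
proof -
  have "r t \<in> topspace X"
    using r t by (auto simp: differentiable_curve_def continuous_map_def)
  then obtain c where c: "c \<in> A" "r t \<in> chart_dom c"
    using ex_chart[OF M] by blast
  obtain G :: "'b \<Rightarrow> ('b \<Rightarrow>\<^sub>L 'b \<Rightarrow>\<^sub>L real)" where sG: "smooth_on (chart_img c) G"
     and G: "\<And>x v w. x \<in> chart_img c \<Longrightarrow> metric_rep A g c x v w = G x v w"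
    using riemannian_metric_chartE[OF R c(1)] by metis
  define x where "x = chart_map c (r t)"
  define z where "z = velocity A I r t c"
  define v where "v = V t c"
  define w where "w = - \<Gamma> c x z v"
  have x: "x \<in> chart_img c" using c by (simp add: x_def chart_map_in_img)
  have op: "open (chart_img c)" using M c by (auto simp: smooth_manifold_def)
  obtain G' where G': "(G has_derivative G') (at x)"
    using smooth_on_imp_has_derivative[OF sG op x] by blast
  \<comment> \<open>Compatibility concerns real functions with fixed vectors, whereas the product
    rule needs the derivative \<open>G'\<close> of the operator-valued map. The derivative of
    \<open>\<lambda>y. G y v v\<close> is therefore computed in both ways and compared.\<close>
  have "((\<lambda>y. metric_rep A g c y v v) has_derivative
         (\<lambda>z. metric_rep A g c x (\<Gamma> c x z v) v + metric_rep A g c x v (\<Gamma> c x z v))) (at x)"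
    using L c x by (auto simp: levi_civita_def)
  then have "((\<lambda>y. metric_rep A g c y v v) has_derivative
         (\<lambda>z. G x (\<Gamma> c x z v) v + G x v (\<Gamma> c x z v))) (at x)"
    by (simp add: G x)
  then have "((\<lambda>y. G y v v) has_derivative (\<lambda>z. G x (\<Gamma> c x z v) v + G x v (\<Gamma> c x z v))) (at x)"
    by (rule has_derivative_transform_within_open[OF _ op x]) (simp add: G)
  moreover have "((\<lambda>y. G y v v) has_derivative (\<lambda>z. G' z v v)) (at x)"
    by (auto intro!: derivative_eq_intros G')
  ultimately have "(\<lambda>z. G' z v v) = (\<lambda>z. G x (\<Gamma> c x z v) v + G x v (\<Gamma> c x z v))"
    by (rule has_derivative_unique[symmetric])
  then have G'z: "G' z v v = - G x w v - G x v w"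
    unfolding w_def by (metis (no_types, lifting) blinfun.minus_left blinfun.minus_right
        add_uminus_conv_diff minus_minus)
  have cr: "((\<lambda>s. chart_map c (r s)) has_derivative (\<lambda>h. h *\<^sub>R z)) (at t within I)"
    using velocity_has_vector_derivative[OF r c(1) t c(2)]
    by (simp add: has_vector_derivative_def o_def z_def)
  have Gr: "((\<lambda>s. G (chart_map c (r s))) has_derivative (\<lambda>h. G' (h *\<^sub>R z))) (at t within I)"
    using has_derivative_compose[OF cr] G' by (simp add: x_def)
  have Vd: "((\<lambda>s. V s c) has_derivative (\<lambda>h. h *\<^sub>R w)) (at t within I)"
    using V c t unfolding parallel_along_def has_vector_derivative_def x_def w_def z_def v_def by blast
  have "G' (h *\<^sub>R z) = h *\<^sub>R G' z" for h
    using linear_scale[OF has_derivative_linear[OF G']] .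
  then have "((\<lambda>s. G (chart_map c (r s)) (V s c) (V s c)) has_derivative (\<lambda>h. h *\<^sub>R 0)) (at t within I)"
    by (auto intro!: derivative_eq_intros Gr Vd
      simp: x_def[symmetric] v_def[symmetric] blinfun.scaleR_left blinfun.scaleR_right G'z blinfun.add_left
        algebra_simps)
  then have d: "((\<lambda>s. G (chart_map c (r s)) (V s c) (V s c)) has_vector_derivative 0) (at t within I)"
    by (simp add: has_vector_derivative_def)
  \<comment> \<open>The chart expression equals the value of \<open>g\<close> while
    \<open>r s\<close> stays in the chart, which continuity of \<open>r\<close> ensures near
    \<open>t\<close>.\<close>
  have eq: "G (chart_map c (r s)) (V s c) (V s c) = g (r s) (V s) (V s)"
    if "r s \<in> chart_dom c" "s \<in> I" for s
    using metric_rep_tangent[where g = g and \<xi> = "V s", OF M _ c(1) that(1)] V that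
    by (simp add: parallel_along_def G chart_map_in_img)
  have "\<forall>\<^sub>F s in at t within I. s \<in> I"
    by (simp add: eventually_at_filter)
  with eventually_in_chart_dom[OF M r c(1) t c(2)]
  have "\<forall>\<^sub>F s in at t within I. G (chart_map c (r s)) (V s c) (V s c) = g (r s) (V s) (V s)"
    by eventually_elim (use eq in auto)
  with d show ?thesis
    unfolding has_vector_derivative_def
    by (rule has_derivative_transform_eventually) (simp_all only: eq[OF c(2) t] t)
qed

lemma parallel_norm_constant:
  assumes "smooth_manifold X A" "riemannian_metric A g" "levi_civita A g \<Gamma>"
    and "differentiable_curve X A I r" "parallel_along A \<Gamma> I r V"
    and "convex I" "s \<in> I" "t \<in> I"
  shows "g (r s) (V s) (V s) = g (r t) (V t) (V t)"
proof -
  have "((\<lambda>s. g (r s) (V s) (V s)) has_derivative (\<lambda>h. 0)) (at t within I)" if "t \<in> I" for t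
    using parallel_norm_derivative[OF assms(1-5) that] by (simp add: has_vector_derivative_def)
  then show ?thesis
    using has_derivative_zero_unique[OF assms(6)] assms(7,8) by blast
qed

lemma parallel_along_unique:
  assumes M: "smooth_manifold X A" and R: "riemannian_metric A g" and L: "levi_civita A g \<Gamma>"
    and r: "differentiable_curve X A I r" and "convex I"
    and V: "parallel_along A \<Gamma> I r V" and W: "parallel_along A \<Gamma> I r W"
    and "s \<in> I" "t \<in> I" and eq: "V s = W s"
  shows "V t = W t"
proof -
  let ?U = "\<lambda>t c. V t c - W t c"
  have U: "parallel_along A \<Gamma> I r ?U"
    using parallel_along_diff[OF M V W] .
  have UT: "?U t \<in> tangent_space A (r t)" "?U s \<in> tangent_space A (r s)"
    using U \<open>t \<in> I\<close> \<open>s \<in> I\<close> by (auto simp: parallel_along_def)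
  have top: "r t \<in> topspace X" "r s \<in> topspace X"
    using r \<open>t \<in> I\<close> \<open>s \<in> I\<close> by (auto simp: differentiable_curve_def continuous_map_def)
  \<comment> \<open>The zero vector is written as a multiple by \<open>0\<close>, so that
    homogeneity of the length shows its length to be zero.\<close>
  have "?U s = tscale 0 (?U s)"
    using eq by (simp add: tscale_def)
  then have "tnorm g (r s) (?U s) = 0"
    using tnorm_tscale[OF M R top(2) UT(2), of 0] UT(2) by simp
  then have "g (r s) (?U s) (?U s) = 0"
    by (simp add: tnorm_def)
  then have "g (r t) (?U t) (?U t) = 0"
    using parallel_norm_constant[OF M R L r U \<open>convex I\<close> \<open>t \<in> I\<close> \<open>s \<in> I\<close>] by simp
  then have "?U t = (\<lambda>c. 0)"
    using tangent_vector_eq_zero[OF M R top(1) UT(1)] by blast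
  then show ?thesis
    by (metis eq_iff_diff_eq_0 ext)
qed

text \<open>The velocity of a geodesic is parallel by definition and serves as the witness for
  \<open>THE\<close>; any other parallel field that agrees with it at \<open>s\<close> agrees with
  it at \<open>t\<close>.\<close>

lemma parallel_translation_velocity:
  assumes "smooth_manifold X A" "riemannian_metric A g" "levi_civita A g \<Gamma>"
    and "geodesic X A \<Gamma> I r" "convex I" "s \<in> I" "t \<in> I"
  shows "parallel_translation A \<Gamma> I r s t (velocity A I r s) = velocity A I r t"
  unfolding parallel_translation_def
proof (rule the_equality)
  show "\<exists>V. parallel_along A \<Gamma> I r V \<and> V s = velocity A I r s \<and> V t = velocity A I r t"
    using assms(4) by (auto simp: geodesic_def)
next
  fix \<zeta>
  assume "\<exists>V. parallel_along A \<Gamma> I r V \<and> V s = velocity A I r s \<and> V t = \<zeta>"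
  then obtain V where "parallel_along A \<Gamma> I r V" "V s = velocity A I r s" "V t = \<zeta>"
    by blast
  then show "\<zeta> = velocity A I r t"
    using parallel_along_unique[OF assms(1-3) _ assms(5) _ _ assms(6,7), of r V "velocity A I r"]
      assms(4) by (simp add: geodesic_def)
qed

section \<open>The differential of \<open>h\<close> and its chain rule\<close>

lemma differential_works:
  assumes M: "smooth_manifold X A" and S: "S \<subseteq> topspace X" and h: "C1_on A S h" and p: "p \<in> S"
  obtains c where "c \<in> A" "p \<in> chart_dom c"
    "\<And>\<xi>. differential A h p \<xi> = frechet_derivative (h \<circ> chart_inv c) (at (chart_map c p)) (\<xi> c)"
    "((h \<circ> chart_inv c) has_derivative
       frechet_derivative (h \<circ> chart_inv c) (at (chart_map c p))) (at (chart_map c p))"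
proof -
  \<comment> \<open>The same choice as inside \<open>differential\<close>, so that no change of
    charts is needed.\<close>
  define c where "c = (SOME c. c \<in> A \<and> p \<in> chart_dom c)"
  have "\<exists>c. c \<in> A \<and> p \<in> chart_dom c"
    using ex_chart[OF M] S p by blast
  then have c: "c \<in> A \<and> p \<in> chart_dom c"
    unfolding c_def by (rule someI_ex)
  show ?thesis
  proof (rule that)
    show "differential A h p \<xi> = frechet_derivative (h \<circ> chart_inv c) (at (chart_map c p)) (\<xi> c)"
      for \<xi> by (simp add: differential_def c_def Let_def)
    have "(h \<circ> chart_inv c) differentiable (at (chart_map c p))"
      using h c p unfolding C1_on_def by (meson IntI differentiableI imageI)
    then show "((h \<circ> chart_inv c) has_derivative
       frechet_derivative (h \<circ> chart_inv c) (at (chart_map c p))) (at (chart_map c p))"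
      by (simp add: frechet_derivative_works)
  qed (use c in auto)
qed

lemma differential_tscale:
  assumes "smooth_manifold X A" "S \<subseteq> topspace X" "C1_on A S h" "p \<in> S"
  shows "differential A h p (tscale a \<xi>) = a * differential A h p \<xi>"
proof -
  obtain c where "\<And>\<xi>. differential A h p \<xi>
      = frechet_derivative (h \<circ> chart_inv c) (at (chart_map c p)) (\<xi> c)"
    and d: "((h \<circ> chart_inv c) has_derivative
       frechet_derivative (h \<circ> chart_inv c) (at (chart_map c p))) (at (chart_map c p))"
    using differential_works[OF assms] by blast
  then show ?thesis
    using linear_scale[OF has_derivative_linear[OF d]] by (simp add: tscale_def)
qed

text \<open>The chain rule in the chart chosen by \<open>differential\<close>. Passing through
  \<open>chart_inv c\<close> recovers \<open>h (r s)\<close> as long as \<open>r s\<close> lies in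
  that chart, hence for all \<open>s\<close> near \<open>t\<close>, and this determines the
  derivative.\<close>

lemma has_vector_derivative_along_curve:
  assumes M: "smooth_manifold X A" and S: "S \<subseteq> topspace X" and h: "C1_on A S h"
    and r: "differentiable_curve X A I r" and t: "t \<in> I" and p: "r t \<in> S"
  shows "((\<lambda>s. h (r s)) has_vector_derivative differential A h (r t) (velocity A I r t))
    (at t within I)"
proof -
  obtain c where c: "c \<in> A" "r t \<in> chart_dom c"
    and dh: "\<And>\<xi>. differential A h (r t) \<xi>
      = frechet_derivative (h \<circ> chart_inv c) (at (chart_map c (r t))) (\<xi> c)"
    and d: "((h \<circ> chart_inv c) has_derivative
       frechet_derivative (h \<circ> chart_inv c) (at (chart_map c (r t)))) (at (chart_map c (r t)))"
    using differential_works[OF M S h p] by blast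
  have cr: "((\<lambda>s. chart_map c (r s)) has_derivative (\<lambda>y. y *\<^sub>R velocity A I r t c)) (at t within I)"
    using velocity_has_vector_derivative[OF r c(1) t c(2)]
    by (simp add: has_vector_derivative_def o_def)
  have "((\<lambda>s. (h \<circ> chart_inv c) (chart_map c (r s))) has_derivative
      (\<lambda>y. y *\<^sub>R differential A h (r t) (velocity A I r t))) (at t within I)"
    using has_derivative_compose[OF cr d] linear_scale[OF has_derivative_linear[OF d]]
    by (simp add: dh)
  moreover have "\<forall>\<^sub>F s in at t within I. (h \<circ> chart_inv c) (chart_map c (r s)) = h (r s)"
    using eventually_in_chart_dom[OF M r c(1) t c(2)]
    by eventually_elim (use chart_inv_chart_map[OF M c(1)] in auto)
  ultimately show ?thesis
    unfolding has_vector_derivative_def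
    by (rule has_derivative_transform_eventually) (use chart_inv_chart_map[OF M c] t in auto)
qed

section \<open>Geodesics of the invex set and estimates on \<open>[0,1]\<close>\<close>

lemma invex_geodesic_geod:
  assumes "geodesic_invex X A \<Gamma> \<eta> S" "u \<in> S" "v \<in> S"
  shows "invex_geodesic X A \<Gamma> \<eta> S u v (geod X A \<Gamma> \<eta> S u v)"
  unfolding geod_def using assms theI'[of "invex_geodesic X A \<Gamma> \<eta> S u v"]
  by (simp add: geodesic_invex_def)

text \<open>With \<open>m = Suc n\<close>, the factor \<open>s * (1 - s)\<close> comes out of the
  right-hand side and leaves \<open>(1 - s) ^ n + s ^ n\<close>. One of the two bases is at least
  \<open>1/2\<close>, whence the bound \<open>(1/2) ^ n\<close>.\<close>

lemma convex_weights_power_ge: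
  fixes s :: real
  assumes "0 \<le> s" "s \<le> 1" "m > 0"
  shows "s * (1 - s) / 2 ^ (m - 1) \<le> s * (1 - s) ^ m + (1 - s) * s ^ m"
proof -
  obtain n where n: "m = Suc n" using assms(3) gr0_implies_Suc by blast
  have "(1/2) ^ n \<le> (1 - s) ^ n + s ^ n"
  proof (cases "s \<le> 1/2")
    case True
    then have "(1/2) ^ n \<le> (1 - s) ^ n" by (intro power_mono) auto
    then show ?thesis using assms by (simp add: add_increasing2)
  next
    case False
    then have "(1/2) ^ n \<le> s ^ n" by (intro power_mono) auto
    then show ?thesis using assms by (simp add: add_increasing)
  qed
  then have "s * (1 - s) * (1/2) ^ n \<le> s * (1 - s) * ((1 - s) ^ n + s ^ n)"
    using assms by (intro mult_left_mono) auto
  then show ?thesis by (simp add: n power_divide algebra_simps)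
qed

text \<open>For \<open>s > 0\<close> the difference quotient is at most
  \<open>a - b * (1 - s)\<close>, and both sides have a limit at \<open>0\<close> from the
  right.\<close>

lemma right_derivative_le:
  fixes f :: "real \<Rightarrow> real"
  assumes d: "(f has_vector_derivative D) (at 0 within {0..1})"
    and le: "\<And>s. s \<in> {0..1} \<Longrightarrow> f s \<le> f 0 + s * (a - b * (1 - s))"
  shows "D \<le> a - b"
proof -
  have "((\<lambda>s. (f s - f 0) / (s - 0)) \<longlongrightarrow> D) (at 0 within {0..1})"
    using d by (simp add: has_field_derivative_iff flip: has_real_derivative_iff_has_vector_derivative)
  moreover have "((\<lambda>s. a - b * (1 - s)) \<longlongrightarrow> a - b * (1 - 0)) (at 0 within {0..1})"
    by (intro tendsto_intros)
  moreover have "\<forall>\<^sub>F s in at 0 within {0..1}. (f s - f 0) / (s - 0) \<le> a - b * (1 - s)"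
    unfolding eventually_at_filter
  proof (intro always_eventually allI impI)
    fix s :: real assume "s \<noteq> 0" "s \<in> {0..1}"
    then show "(f s - f 0) / (s - 0) \<le> a - b * (1 - s)"
      using le[of s] by (simp add: divide_le_eq mult.commute)
  qed
  \<comment> \<open>Inequalities pass to limits only along a nontrivial filter.\<close>
  moreover have "at (0::real) within {0..1} \<noteq> bot"
    by (simp add: at_within_Icc_at_right)
  ultimately show ?thesis
    using tendsto_le by fastforce
qed

section \<open>Strong invexity and strong geodesic preinvexity\<close>

theorem theorem4:
  fixes X :: "'a topology"
    and A :: "('a, 'e::{real_inner, banach}) chart set"
    and g :: "'a \<Rightarrow> ('a, 'e) tvec \<Rightarrow> ('a, 'e) tvec \<Rightarrow> real"
    and \<Gamma> :: "('a, 'e) chart \<Rightarrow> 'e \<Rightarrow> ('e \<Rightarrow>\<^sub>L 'e \<Rightarrow>\<^sub>L 'e)"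
    and \<eta> :: "'a \<Rightarrow> 'a \<Rightarrow> ('a, 'e) tvec"
    and S :: "'a set" and h :: "'a \<Rightarrow> real" and m :: nat
  assumes "smooth_manifold X A"
    and "riemannian_metric A g"
    and "levi_civita A g \<Gamma>"
    and "\<And>u v. u \<in> topspace X \<Longrightarrow> v \<in> topspace X \<Longrightarrow> \<eta> u v \<in> tangent_space A v"
    and "m > 0"
    and "openin X S"
    and "geodesic_invex X A \<Gamma> \<eta> S"
    and "C1_on A S h"
    and "condition_C X A \<Gamma> \<eta> S"
  shows "strongly_invex A g \<eta> S m h \<longleftrightarrow> strongly_geodesic_preinvex X A g \<Gamma> \<eta> S m h"
proof
  have S: "S \<subseteq> topspace X"
    using assms(6) by (rule openin_subset)
  have inv: "invex_geodesic X A \<Gamma> \<eta> S u v (geod X A \<Gamma> \<eta> S u v)" if "u \<in> S" "v \<in> S" for u v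
    using invex_geodesic_geod[OF assms(7) that] .
  {
    assume "strongly_geodesic_preinvex X A g \<Gamma> \<eta> S m h"
    then obtain \<delta> where "\<delta> > 0" and pre: "\<And>u v s. u \<in> S \<Longrightarrow> v \<in> S \<Longrightarrow> s \<in> {0..1} \<Longrightarrow>
       h (geod X A \<Gamma> \<eta> S u v s)
         \<le> s * h u + (1 - s) * h v - \<delta> * s * (1 - s) * tnorm g v (\<eta> u v) ^ m"
      unfolding strongly_geodesic_preinvex_def by blast
    \<comment> \<open>The same \<open>\<delta>\<close> serves, because the factor
      \<open>1 - s\<close> of the preinvexity bound tends to \<open>1\<close> as \<open>s\<close>
      tends to \<open>0\<close>.\<close>
    have "h u \<ge> h v + differential A h v (\<eta> u v) + \<delta> * tnorm g v (\<eta> u v) ^ m"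
      if uv: "u \<in> S" "v \<in> S" for u v
    proof -
      let ?r = "geod X A \<Gamma> \<eta> S u v"
      have r: "differentiable_curve X A {0..1} ?r" "?r 0 = v" "velocity A {0..1} ?r 0 = \<eta> u v"
        using inv[OF uv] by (auto simp: invex_geodesic_def geodesic_def)
      have "((\<lambda>s. h (?r s)) has_vector_derivative differential A h v (\<eta> u v)) (at 0 within {0..1})"
        using has_vector_derivative_along_curve[OF assms(1) S assms(8) r(1), of 0] r(2,3) uv(2)
        by simp
      then have "differential A h v (\<eta> u v) \<le> (h u - h v) - \<delta> * tnorm g v (\<eta> u v) ^ m"
      proof (rule right_derivative_le)
        \<comment> \<open>Preinvexity regrouped around \<open>h (?r 0) = h v\<close>, with
          \<open>a = h u - h v\<close> and
          \<open>b = \<delta> * tnorm g v (\<eta> u v) ^ m\<close>.\<close>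
        fix s :: real assume "s \<in> {0..1}"
        then show "h (?r s) \<le> h (?r 0)
            + s * ((h u - h v) - \<delta> * tnorm g v (\<eta> u v) ^ m * (1 - s))"
          using pre[OF uv, of s] by (simp add: r(2) algebra_simps)
      qed
      then show ?thesis by simp
    qed
    then show "strongly_invex A g \<eta> S m h"
      using \<open>\<delta> > 0\<close> unfolding strongly_invex_def by blast
  }
  {
    assume "strongly_invex A g \<eta> S m h"
    then obtain \<delta> where "\<delta> > 0" and invex: "\<And>u v. u \<in> S \<Longrightarrow> v \<in> S \<Longrightarrow>
       h u \<ge> h v + differential A h v (\<eta> u v) + \<delta> * tnorm g v (\<eta> u v) ^ m"
      unfolding strongly_invex_def by blast
    \<comment> \<open>The divisor \<open>2 ^ (m - 1)\<close> is the one in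
      \<open>convex_weights_power_ge\<close>.\<close>
    have "h (geod X A \<Gamma> \<eta> S u v s)
         \<le> s * h u + (1 - s) * h v - \<delta> / 2 ^ (m - 1) * s * (1 - s) * tnorm g v (\<eta> u v) ^ m"
      if uv: "u \<in> S" "v \<in> S" and s: "s \<in> {0..1}" for u v s
    proof -
      define r where "r = geod X A \<Gamma> \<eta> S u v"
      define \<zeta> where "\<zeta> = velocity A {0..1} r s"
      define N where "N = tnorm g v (\<eta> u v)"
      define p where "p = r s"
      have r: "geodesic X A \<Gamma> {0..1} r" "r 0 = v" "velocity A {0..1} r 0 = \<eta> u v" "p \<in> S"
        using inv[OF uv] s unfolding invex_geodesic_def r_def p_def by auto
      have p: "p \<in> topspace X" using r(4) S by blast
      \<comment> \<open>Since \<open>\<eta> u v\<close> is the initial velocity of \<open>r\<close>,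
        the translated vector in Condition C is the velocity \<open>\<zeta>\<close> at
        \<open>s\<close>.\<close>
      have "parallel_translation A \<Gamma> {0..1} r 0 s (\<eta> u v) = \<zeta>"
        using parallel_translation_velocity[OF assms(1-3) r(1), of 0 s] r(3) s by (simp add: \<zeta>_def)
      then have \<eta>: "\<eta> v p = tscale (- s) \<zeta>" "\<eta> u p = tscale (1 - s) \<zeta>"
        using assms(9) uv s unfolding condition_C_def Let_def r_def p_def by metis+
      have "\<zeta> \<in> tangent_space A p"
        using r(1) s by (auto simp: geodesic_def parallel_along_def \<zeta>_def p_def)
      moreover have "\<eta> u p \<in> tangent_space A p" "\<eta> v p \<in> tangent_space A p"
        using assms(4) uv S p by blast+
      \<comment> \<open>Constant speed: \<open>N\<close> is the speed of \<open>r\<close> at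
        parameter \<open>0\<close> and recurs at \<open>s\<close>.\<close>
      moreover have "tnorm g p \<zeta> = N"
        using parallel_norm_constant[OF assms(1-3), of "{0..1}" r "velocity A {0..1} r" s 0] r s
        by (simp add: tnorm_def N_def \<zeta>_def p_def geodesic_def)
      ultimately have n: "tnorm g p (\<eta> u p) = (1 - s) * N" "tnorm g p (\<eta> v p) = s * N"
        using tnorm_tscale[OF assms(1,2) p] s \<eta> by simp_all
      define D where "D = differential A h p \<zeta>"
      have "h u \<ge> h p + (1 - s) * D + \<delta> * ((1 - s) * N) ^ m"
        using invex[OF uv(1) r(4)] n(1) differential_tscale[OF assms(1) S assms(8) r(4)] \<eta>(2)
        by (simp add: D_def)
      \<comment> \<open>The weights \<open>s\<close> here and \<open>1 - s\<close> below are matched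
        to the coefficients \<open>1 - s\<close> and \<open>- s\<close> of \<open>D\<close>.\<close>
      then have 1: "s * h u \<ge> s * (h p + (1 - s) * D + \<delta> * ((1 - s) * N) ^ m)"
        using s by (simp add: mult_left_mono)
      have "h v \<ge> h p - s * D + \<delta> * (s * N) ^ m"
        using invex[OF uv(2) r(4)] n(2) differential_tscale[OF assms(1) S assms(8) r(4)] \<eta>(1)
        by (simp add: D_def)
      then have 2: "(1 - s) * h v \<ge> (1 - s) * (h p - s * D + \<delta> * (s * N) ^ m)"
        using s by (simp add: mult_left_mono)
      \<comment> \<open>This makes \<open>\<delta> * N ^ m\<close> nonnegative, so the inequality
        between the weights may be multiplied by it.\<close>
      have "0 \<le> N"
        using tnorm_nonneg[OF assms(1,2)] assms(4) uv S unfolding N_def by blast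
      then have "\<delta> * N ^ m * (s * (1 - s) / 2 ^ (m - 1))
          \<le> \<delta> * N ^ m * (s * (1 - s) ^ m + (1 - s) * s ^ m)"
        using convex_weights_power_ge[of s m] s assms(5) \<open>\<delta> > 0\<close> by (intro mult_left_mono) auto
      \<comment> \<open>The terms \<open>s * (1 - s) * D\<close> and
        \<open>- (1 - s) * s * D\<close> cancel, the weights of \<open>h p\<close> add up to
        \<open>1\<close>, and \<open>N ^ m\<close> factors out of both powers.\<close>
      moreover have "s * (h p + (1 - s) * D + \<delta> * ((1 - s) * N) ^ m)
          + (1 - s) * (h p - s * D + \<delta> * (s * N) ^ m)
          = h p + \<delta> * N ^ m * (s * (1 - s) ^ m + (1 - s) * s ^ m)"
        unfolding power_mult_distrib by (simp add: algebra_simps)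
      ultimately have "h p \<le> s * h u + (1 - s) * h v - \<delta> * N ^ m * (s * (1 - s) / 2 ^ (m - 1))"
        using 1 2 by linarith
      then show ?thesis
        by (simp add: p_def r_def N_def mult_ac)
    qed
    then show "strongly_geodesic_preinvex X A g \<Gamma> \<eta> S m h"
      using \<open>\<delta> > 0\<close> unfolding strongly_geodesic_preinvex_def
      by (intro exI[of _ "\<delta> / 2 ^ (m - 1)"]) auto
  }
qed

end
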